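(* Let $n,\ell,m\ge1$ be integers, $\nu\in\mathbb N^\ell$ a composition of $m$, $\kappa\in\mathbb C\setminus\mathbb Q_{\ge0}$, $h=1/\kappa$, and $h_p=\nu_{\ell-p}/\kappa-m/(\ell\kappa)$ for $1\le p\le\ell-1$, $h_\ell=\nu_\ell/\kappa-m/(\ell\kappa)$. If $\lambda,\mu\in\mathcal P^\ell_{n,\nu}$ and $\Delta_{\mu,\nu,\kappa}\trianglelefteq\Delta_{\lambda,\nu,\kappa}$, then $\Delta_{\mu^\circ,h,H}\preccurlyeq\Delta_{\lambda^\circ,h,H}$.
   Context: **Combinatorics.** $\mathcal P^\ell_{n,\nu}$ is the set of $\ell$-tuples $\lambda=(\lambda_1,\dots,\lambda_\ell)$ of partitions with $\sum_p|\lambda_p|=n$ and $\lambda_p$ having at most $\nu_p$ parts; such $\lambda$ is viewed as an element of $\mathbb C^m$ by completing each $\lambda_p$ with zeroes to length $\nu_p$ and concatenating. $\lambda^\circ=(\lambda_\ell,\dots,\lambda_1)$. $\{1,\dots,m\}=J_1\sqcup\dots\sqcup J_\ell$ is the partition into consecutive intervals with $|J_p|=\nu_p$. For a partition $\lambda$, $n(\lambda)=\sum_i(i-1)\lambda_i$ and ${}^t\lambda$ is the transpose. **Order $\trianglelefteq$ (affine side).** Put $c=\kappa-m$. Let $\mathbf t^*=\mathbb C\delta\oplus\mathbb C^m\oplus\mathbb C\omega_0$ ("affine weights"), $\epsilon_1,\dots,\epsilon_m$ the canonical basis of $\mathbb C^m$, with the symmetric bilinear form $\langle\epsilon_i:\epsilon_j\rangle=\delta_{ij}$,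 $\langle\omega_0:\delta\rangle=1$, and all other pairings of $\delta,\omega_0,\epsilon_i$ zero. Real roots are $\epsilon_i-\epsilon_j+r\delta$ ($i\ne j$, $r\in\mathbb Z$); the positive ones $\hat\Pi^+_{re}$ are those with $r>0$, or $r=0$ and $i<j$. $\hat\Pi^+$ consists of $\hat\Pi^+_{re}$ and the $r\delta$, $r>0$. $\Pi_\nu$ is the set of $\epsilon_i-\epsilon_j$ with $i\ne j$ in the same $J_p$, $\Pi^+_\nu$ those with $i<j$, and $\mathfrak S_\nu=\prod_p\mathfrak S_{J_p}$. $\rho=(m,\dots,2,1)$, $\hat\rho=\rho+m\omega_0$; $s_\alpha(\lambda)=\lambda-\langle\lambda:\alpha\rangle\alpha$; $w\bullet\lambda=w(\lambda+\hat\rho)-\hat\rho$. An affine weight is $\nu$-dominant if its component in $\mathbb C^m$ satisfies $\lambda_i-\lambda_{i+1}\in\mathbb N$ whenever $i,i+1$ are in the same $J_p$; it is $\nu$-regular if $\langle\lambda:\alpha\rangle\neq0$ for all $\alpha\in\Pi_\nu$. If $\lambda+\hat\rho$ is $\nu$-regular with $\langle\lambda:\alpha\rangle\in\mathbb Z$ for $\alpha\in\Pi_\nu$, let $\lambda_+$ be the unique $\nu$-dominant element of $\mathfrak S_\nu\bullet\lambda$. Write $\lambda<\mu$ if $0\ne\mu-\lambda\in\mathbb N\hat\Pi^+$. On $\nu$-dominant affine weights, $\trianglelefteq$ is the reflexive transitive closure of the relation: $\lambda\uparrow\mu$ iff there is $\alpha\in\hat\Pi^+_{re}\setminus\Pi^+_\nu$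 with $\langle\mu+\hat\rho:\alpha\rangle\in\mathbb Z_{>0}$, $s_\alpha\bullet\mu+\hat\rho$ $\nu$-regular, and $\lambda=(s_\alpha\bullet\mu)_+<\mu$. For $\lambda\in\mathbb C^m$ put $\tilde\lambda=\lambda+c\omega_0+z_\lambda\delta$, $z_\lambda=-\langle\lambda:2\rho+\lambda\rangle/2\kappa$. Let $\pi\in\mathbb C^m$ have $j$-th entry $-pc/\ell$ for $j\in J_p$. The $\Delta_{\lambda,\nu,\kappa}$ are the parabolic Verma modules of $\widehat{\mathfrak{gl}}_m$ of level $c$ with highest weight $\widetilde{\lambda+\pi}$ (for the parabolic with Levi $\prod_p\mathfrak{gl}_{\nu_p}$), and $\Delta_{\mu,\nu,\kappa}\trianglelefteq\Delta_{\lambda,\nu,\kappa}$ means $\widetilde{\mu+\pi}\trianglelefteq\widetilde{\lambda+\pi}$. **Order $\preccurlyeq$ (Cherednik algebra side).** The $\Delta_{\lambda,h,H}$, indexed by $\ell$-partitions $\lambda$ of $n$, are the standard modules of the cyclotomic rational double affine Hecke algebra of $\mathfrak S_n\ltimes(\mathbb Z/\ell\mathbb Z)^n$ with parameters $h$, $H=(h_1,\dots,h_{\ell-1})$. For an $\ell$-partition $\lambda$ of $n$ put $$\theta_\lambda=\ell\sum_{p=2}^\ell|\lambda_p|(h_1+\dots+h_{p-1})-h\ell\sum_p\bigl(n(\lambda_p)-n({}^t\lambda_p)\bigr)$$ (up to an additive constant independent of $\lambda$, the scalar by which the Euler element acts on the lowest weight space of $\Delta_{\lambda,h,H}$). The partial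 order is: $\Delta_{\mu,h,H}\succ\Delta_{\lambda,h,H}$ iff $\theta_\lambda-\theta_\mu\in\mathbb Z_{>0}$; and $\preccurlyeq$ means $\prec$ or equal. *)

theory Defs
  imports
    Complex_Main
    "HOL-Combinatorics.Permutations"
    "HOL-Library.Product_Plus"
    "HOL-Library.Function_Algebras"
begin

text \<open>Tuples are lists; the entries of tuples are numbered from 1, as in the mathematics.\<close>

abbreviation nth1 :: "'a list \<Rightarrow> nat \<Rightarrow> 'a" where
  "nth1 xs p \<equiv> xs ! (p - 1)"

text \<open>A partition is the list of its positive parts, so that a partition has a unique
  representation and its number of parts is its length.\<close>

definition is_partition :: "nat list \<Rightarrow> bool" where
  "is_partition a \<longleftrightarrow> sorted_wrt (\<ge>) a \<and> 0 \<notin> set a"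

definition conj_partition :: "nat list \<Rightarrow> nat list" where
  "conj_partition a = map (\<lambda>j. card {i. i < length a \<and> j < a ! i}) [0..<Max (insert 0 (set a))]"

text \<open>Here the list index \<open>i\<close> starts at 0 and so is the factor written $i-1$ in
  $n(\lambda)=\sum_i (i-1)\lambda_i$.\<close>

definition n_stat :: "nat list \<Rightarrow> nat" where
  "n_stat a = (\<Sum>i<length a. i * a ! i)"

definition multipartitions :: "nat \<Rightarrow> nat list \<Rightarrow> nat list list set" where
  "multipartitions n \<nu> = {lam. length lam = length \<nu>
     \<and> (\<forall>p\<in>{1..length \<nu>}. is_partition (nth1 lam p) \<and> length (nth1 lam p) \<le> nth1 \<nu> p)
     \<and> (\<Sum>p=1..length \<nu>. sum_list (nth1 lam p)) = n}"

text \<open>Elements of $\mathbb C^m$ are functions on the naturals that vanish outside \<open>{1..m}\<close>.\<close>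

definition vec_of_list :: "nat list \<Rightarrow> nat \<Rightarrow> complex" where
  "vec_of_list xs i = (if i \<in> {1..length xs} then of_nat (nth1 xs i) else 0)"

definition multipartition_vec :: "nat list \<Rightarrow> nat list list \<Rightarrow> nat \<Rightarrow> complex" where
  "multipartition_vec \<nu> lam =
     vec_of_list (concat (map2 (\<lambda>a k. a @ replicate (k - length a) 0) lam \<nu>))"

definition block :: "nat list \<Rightarrow> nat \<Rightarrow> nat set" where
  "block \<nu> p = {sum_list (take (p - 1) \<nu>) <.. sum_list (take p \<nu>)}"

text \<open>The triple \<open>(z, v, k)\<close> stands for $z\delta + v + k\omega_0$.\<close>

type_synonym aweight = "complex \<times> (nat \<Rightarrow> complex) \<times> complex"

definition affine_weights :: "nat \<Rightarrow> aweight set" where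
  "affine_weights m = {(z, v, k) | z v k. \<forall>i. i \<notin> {1..m} \<longrightarrow> v i = 0}"

definition smult_wt :: "complex \<Rightarrow> aweight \<Rightarrow> aweight" (infixr "\<cdot>" 75) where
  "a \<cdot> x = (case x of (z, v, k) \<Rightarrow> (a * z, (\<lambda>i. a * v i), a * k))"

definition delta :: aweight where
  "delta = (1, 0, 0)"

definition omega0 :: aweight where
  "omega0 = (0, 0, 1)"

definition of_vec :: "(nat \<Rightarrow> complex) \<Rightarrow> aweight" where
  "of_vec v = (0, v, 0)"

definition eps :: "nat \<Rightarrow> aweight" where
  "eps i = of_vec (\<lambda>j. if j = i then 1 else 0)"

definition pairing :: "nat \<Rightarrow> aweight \<Rightarrow> aweight \<Rightarrow> complex" where
  "pairing m x y = (case x of (z, v, k) \<Rightarrow> case y of (z', v', k') \<Rightarrow>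
     z * k' + k * z' + (\<Sum>i=1..m. v i * v' i))"

definition pos_real_roots :: "nat \<Rightarrow> aweight set" where
  "pos_real_roots m = {eps i - eps j + of_int r \<cdot> delta | i j (r::int).
     i \<in> {1..m} \<and> j \<in> {1..m} \<and> i \<noteq> j \<and> (r > 0 \<or> r = 0 \<and> i < j)}"

definition pos_roots :: "nat \<Rightarrow> aweight set" where
  "pos_roots m = pos_real_roots m \<union> {of_int r \<cdot> delta | r::int. r > 0}"

definition levi_roots :: "nat list \<Rightarrow> aweight set" where
  "levi_roots \<nu> = {eps i - eps j | i j. i \<noteq> j \<and>
     (\<exists>p\<in>{1..length \<nu>}. i \<in> block \<nu> p \<and> j \<in> block \<nu> p)}"

definition pos_levi_roots :: "nat list \<Rightarrow> aweight set" where
  "pos_levi_roots \<nu> = {eps i - eps j | i j. i < j \<and>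
     (\<exists>p\<in>{1..length \<nu>}. i \<in> block \<nu> p \<and> j \<in> block \<nu> p)}"

definition rho :: "nat \<Rightarrow> nat \<Rightarrow> complex" where
  "rho m i = (if i \<in> {1..m} then of_nat (m + 1 - i) else 0)"

definition rho_hat :: "nat \<Rightarrow> aweight" where
  "rho_hat m = of_vec (rho m) + of_nat m \<cdot> omega0"

text \<open>In definitions that take \<open>\<nu>\<close>, it determines $m$ as \<open>sum_list \<nu>\<close>.\<close>

definition reflection :: "nat \<Rightarrow> aweight \<Rightarrow> aweight \<Rightarrow> aweight" where
  "reflection m \<alpha> x = x - pairing m x \<alpha> \<cdot> \<alpha>"

definition levi_perms :: "nat list \<Rightarrow> (nat \<Rightarrow> nat) set" where
  "levi_perms \<nu> = {w. w permutes {1..sum_list \<nu>} \<and>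
     (\<forall>p\<in>{1..length \<nu>}. w ` block \<nu> p = block \<nu> p)}"

definition perm_act :: "(nat \<Rightarrow> nat) \<Rightarrow> aweight \<Rightarrow> aweight" where
  "perm_act w x = (case x of (z, v, k) \<Rightarrow> (z, (\<lambda>i. v (inv w i)), k))"

definition dot :: "nat \<Rightarrow> (aweight \<Rightarrow> aweight) \<Rightarrow> aweight \<Rightarrow> aweight" where
  "dot m w x = w (x + rho_hat m) - rho_hat m"

definition nu_dominant :: "nat list \<Rightarrow> aweight \<Rightarrow> bool" where
  "nu_dominant \<nu> x \<longleftrightarrow> x \<in> affine_weights (sum_list \<nu>) \<and>
     (case x of (z, v, k) \<Rightarrow>
        \<forall>p\<in>{1..length \<nu>}. \<forall>i. i \<in> block \<nu> p \<and> i + 1 \<in> block \<nu> p \<longrightarrow> v i - v (i + 1) \<in> \<nat>)"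

definition nu_regular :: "nat list \<Rightarrow> aweight \<Rightarrow> bool" where
  "nu_regular \<nu> x \<longleftrightarrow> (\<forall>\<alpha>\<in>levi_roots \<nu>. pairing (sum_list \<nu>) x \<alpha> \<noteq> 0)"

text \<open>The weight $x_+$; it is only meaningful when $x+\hat\rho$ is $\nu$-regular and $x$ pairs
  integrally with \<open>levi_roots \<nu>\<close>.\<close>

definition plus_part :: "nat list \<Rightarrow> aweight \<Rightarrow> aweight" where
  "plus_part \<nu> x = (THE y. nu_dominant \<nu> y \<and>
     y \<in> (\<lambda>w. dot (sum_list \<nu>) (perm_act w) x) ` levi_perms \<nu>)"

text \<open>A natural-number combination of positive roots is a finite sum of positive roots.\<close>

definition wt_less :: "nat \<Rightarrow> aweight \<Rightarrow> aweight \<Rightarrow> bool" where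
  "wt_less m x y \<longleftrightarrow> y - x \<noteq> 0 \<and> y - x \<in> {sum_list \<alpha>s | \<alpha>s. set \<alpha>s \<subseteq> pos_roots m}"

definition linked_up :: "nat list \<Rightarrow> aweight \<Rightarrow> aweight \<Rightarrow> bool" where
  "linked_up \<nu> x y \<longleftrightarrow> nu_dominant \<nu> x \<and> nu_dominant \<nu> y \<and>
     (\<exists>\<alpha> \<in> pos_real_roots (sum_list \<nu>) - pos_levi_roots \<nu>.
        let m = sum_list \<nu>; s = dot m (reflection m \<alpha>) y in
          pairing m (y + rho_hat m) \<alpha> \<in> \<nat> - {0} \<and>
          nu_regular \<nu> (s + rho_hat m) \<and>
          x = plus_part \<nu> s \<and> wt_less m x y)"

definition affine_le :: "nat list \<Rightarrow> aweight \<Rightarrow> aweight \<Rightarrow> bool" where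
  "affine_le \<nu> x y \<longleftrightarrow> nu_dominant \<nu> x \<and> nu_dominant \<nu> y \<and> (linked_up \<nu>)\<^sup>*\<^sup>* x y"

text \<open>The lift $\tilde v$ of $v\in\mathbb C^m$ to a weight of level $c=\kappa-m$.\<close>

definition lift_wt :: "nat \<Rightarrow> complex \<Rightarrow> (nat \<Rightarrow> complex) \<Rightarrow> aweight" where
  "lift_wt m \<kappa> v = of_vec v + (\<kappa> - of_nat m) \<cdot> omega0
     + (- pairing m (of_vec v) (of_vec (\<lambda>i. 2 * rho m i + v i)) / (2 * \<kappa>)) \<cdot> delta"

text \<open>The blocks are disjoint, so at most one summand is nonzero.\<close>

definition pi_vec :: "nat list \<Rightarrow> complex \<Rightarrow> nat \<Rightarrow> complex" where
  "pi_vec \<nu> \<kappa> i = (\<Sum>p=1..length \<nu>. if i \<in> block \<nu> p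
     then - of_nat p * (\<kappa> - of_nat (sum_list \<nu>)) / of_nat (length \<nu>) else 0)"

text \<open>\<open>verma_le \<nu> \<kappa> mu lam\<close> is the relation
  $\Delta_{\mu,\nu,\kappa}\trianglelefteq\Delta_{\lambda,\nu,\kappa}$ between parabolic Verma
  modules, on the labels of the modules; it is by definition the order on their highest weights.\<close>

definition verma_highest_weight :: "nat list \<Rightarrow> complex \<Rightarrow> nat list list \<Rightarrow> aweight" where
  "verma_highest_weight \<nu> \<kappa> lam =
     lift_wt (sum_list \<nu>) \<kappa> (multipartition_vec \<nu> lam + pi_vec \<nu> \<kappa>)"

definition verma_le :: "nat list \<Rightarrow> complex \<Rightarrow> nat list list \<Rightarrow> nat list list \<Rightarrow> bool" where
  "verma_le \<nu> \<kappa> mu lam \<longleftrightarrow>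
     affine_le \<nu> (verma_highest_weight \<nu> \<kappa> mu) (verma_highest_weight \<nu> \<kappa> lam)"

text \<open>\<open>H\<close> is the list of parameters $(h_1,\dots,h_{\ell-1})$.\<close>

definition theta :: "complex \<Rightarrow> complex list \<Rightarrow> nat list list \<Rightarrow> complex" where
  "theta h H lam = (let l = length lam in
     of_nat l * (\<Sum>p=2..l. of_nat (sum_list (nth1 lam p)) * (\<Sum>q=1..p - 1. nth1 H q))
     - h * of_nat l * (\<Sum>p=1..l. of_nat (n_stat (nth1 lam p))
                                 - of_nat (n_stat (conj_partition (nth1 lam p)))))"

text \<open>The relations $\Delta_{\mu,h,H}\prec\Delta_{\lambda,h,H}$ and
  $\Delta_{\mu,h,H}\preccurlyeq\Delta_{\lambda,h,H}$, on the labels of the modules. The larger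
  module has the smaller value of \<open>theta\<close>.\<close>

definition cherednik_less ::
  "complex \<Rightarrow> complex list \<Rightarrow> nat list list \<Rightarrow> nat list list \<Rightarrow> bool" where
  "cherednik_less h H mu lam \<longleftrightarrow> theta h H mu - theta h H lam \<in> \<nat> - {0}"

definition cherednik_le ::
  "complex \<Rightarrow> complex list \<Rightarrow> nat list list \<Rightarrow> nat list list \<Rightarrow> bool" where
  "cherednik_le h H mu lam \<longleftrightarrow> cherednik_less h H mu lam \<or> mu = lam"

end

(* Let L(z delta + v + k omega0) = l z - sum_i p(i) v_i, where p(i) is the index of the block
containing i.  Expressing the Casimir form <v : 2 rho + v> through contents of boxes shows that
theta of the reversed multipartition is, up to a constant, -L of the highest weight.  Since block
indices lie in {1..l} and increase, L is a natural number on every positive root and vanishes only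
on the positive Levi roots; so the difference of the two thetas is a natural number.  If it is 0,
the highest weights differ by a sum of positive Levi roots and have the same delta-component, i.e.
the same Casimir value, which for nu-dominant weights forces them to be equal. *)

theory Submission
  imports Defs
begin

subsection \<open>Blocks\<close>

text \<open>Written as a sum in the same shape as \<open>pi_vec\<close>, so that it is total. The
  blocks are disjoint, hence at most one summand survives, and the value is 0 outside all
  blocks.\<close>

definition block_index :: "nat list \<Rightarrow> nat \<Rightarrow> nat" where
  "block_index \<nu> i = (\<Sum>p=1..length \<nu>. if i \<in> block \<nu> p then p else 0)"

lemma sum_list_take_mono:
  fixes xs :: "nat list"
  assumes "p \<le> q"
  shows "sum_list (take p xs) \<le> sum_list (take q xs)"
proof -
  have "take q xs = take p xs @ take (q - p) (drop p xs)"
    using assms by (metis le_add_diff_inverse take_add)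
  then show ?thesis by simp
qed

lemma block_mono:
  assumes "i \<in> block \<nu> p" "j \<in> block \<nu> q" "i \<le> j"
  shows "p \<le> q"
proof (rule ccontr)
  assume "\<not> p \<le> q"
  then have "sum_list (take q \<nu>) \<le> sum_list (take (p - 1) \<nu>)"
    by (intro sum_list_take_mono) auto
  then show False using assms by (auto simp: block_def)
qed

lemma block_unique: "i \<in> block \<nu> p \<Longrightarrow> i \<in> block \<nu> q \<Longrightarrow> p = q"
  using block_mono by (metis le_antisym le_refl)

lemma block_index_eq:
  assumes "p \<in> {1..length \<nu>}" "i \<in> block \<nu> p"
  shows "block_index \<nu> i = p"
proof -
  have "block_index \<nu> i = (\<Sum>q=1..length \<nu>. if q = p then p else 0)"
    unfolding block_index_def using assms block_unique by (intro sum.cong) auto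
  then show ?thesis using assms by simp
qed

lemma UN_block: "(\<Union>p\<in>{1..length \<nu>}. block \<nu> p) = {1..sum_list \<nu>}"
proof (intro equalityI subsetI)
  fix i assume "i \<in> (\<Union>p\<in>{1..length \<nu>}. block \<nu> p)"
  then obtain p where "i \<in> block \<nu> p" by blast
  \<comment> \<open>Monotonicity is applied up to \<open>max p (length \<nu>)\<close>, where
    \<open>take\<close> returns all of \<open>\<nu>\<close>.\<close>
  moreover have "sum_list (take p \<nu>) \<le> sum_list \<nu>"
    using sum_list_take_mono[of p "max p (length \<nu>)" \<nu>] by simp
  ultimately show "i \<in> {1..sum_list \<nu>}" by (auto simp: block_def)
next
  fix i assume i: "i \<in> {1..sum_list \<nu>}"
  \<comment> \<open>The block of \<open>i\<close> is the first one whose right end reaches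
    \<open>i\<close>; minimality skips empty blocks and puts the left end strictly below
    \<open>i\<close>.\<close>
  define p where "p = (LEAST p. i \<le> sum_list (take p \<nu>))"
  have le: "i \<le> sum_list (take (length \<nu>) \<nu>)" using i by simp
  have p: "i \<le> sum_list (take p \<nu>)" "p \<le> length \<nu>"
    unfolding p_def using le by (rule LeastI, rule Least_le)
  have "p \<noteq> 0" using p(1) i by (cases p) auto
  moreover have "\<not> i \<le> sum_list (take (p - 1) \<nu>)"
    using \<open>p \<noteq> 0\<close> not_less_Least[of "p - 1" "\<lambda>p. i \<le> sum_list (take p \<nu>)"]
    unfolding p_def[symmetric] by simp
  ultimately show "i \<in> (\<Union>p\<in>{1..length \<nu>}. block \<nu> p)"
    using p by (auto simp: block_def intro!: bexI[of _ p])
qed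

lemma sum_blocks: "(\<Sum>i=1..sum_list \<nu>. f i) = (\<Sum>p=1..length \<nu>. \<Sum>i\<in>block \<nu> p. f i)"
proof -
  have disj: "block \<nu> p \<inter> block \<nu> q = {}" if "p \<noteq> q" for p q
    using block_unique that by blast
  have fin: "finite (block \<nu> p)" for p by (simp add: block_def)
  have "sum f (\<Union>p\<in>{1..length \<nu>}. block \<nu> p) = (\<Sum>p=1..length \<nu>. \<Sum>i\<in>block \<nu> p. f i)"
    by (intro sum.UNION_disjoint) (simp_all add: fin disj)
  then show ?thesis by (simp only: UN_block)
qed

text \<open>Translates positions in \<open>{1..m}\<close>, which start at 1, into a block offset
  plus a list index \<open>j\<close> starting at 0, so that \<open>j\<close> also indexes the parts
  of the p-th partition.\<close>

lemma block_conv_image: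
  assumes "p \<in> {1..length \<nu>}"
  shows "block \<nu> p = (\<lambda>j. sum_list (take (p - 1) \<nu>) + j + 1) ` {..<nth1 \<nu> p}"
proof -
  have "sum_list (take p \<nu>) = sum_list (take (p - 1) \<nu>) + nth1 \<nu> p"
    using assms by (cases p) (auto simp: take_Suc_conv_app_nth)
  then have "block \<nu> p = {sum_list (take (p - 1) \<nu>) + 1..<sum_list (take (p - 1) \<nu>) + 1 + nth1 \<nu> p}"
    by (auto simp: block_def)
  also have "\<dots> = (\<lambda>j. sum_list (take (p - 1) \<nu>) + j + 1) ` {..<nth1 \<nu> p}"
    using image_add_atLeastLessThan[of "sum_list (take (p - 1) \<nu>) + 1" 0 "nth1 \<nu> p"]
    by (simp add: atLeast0LessThan add_ac)
  finally show ?thesis .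
qed

lemma sum_block:
  assumes "p \<in> {1..length \<nu>}"
  shows "(\<Sum>i\<in>block \<nu> p. f i) = (\<Sum>j<nth1 \<nu> p. f (sum_list (take (p - 1) \<nu>) + j + 1))"
  unfolding block_conv_image[OF assms] by (subst sum.reindex) (auto simp: inj_on_def)

lemma block_indexE:
  assumes "i \<in> {1..sum_list \<nu>}"
  obtains p where "p \<in> {1..length \<nu>}" "i \<in> block \<nu> p" "block_index \<nu> i = p"
  using assms block_index_eq unfolding UN_block[symmetric] by blast

subsection \<open>Multipartitions as vectors\<close>

lemma nth_concat_offset:
  assumes "p < length xss" "j < length (xss ! p)"
  shows "concat xss ! (sum_list (map length (take p xss)) + j) = xss ! p ! j"
  using assms
proof (induction xss arbitrary: p)
  case (Cons xs xss)
  then show ?case by (cases p) (auto simp: nth_append add.assoc)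
qed simp

lemma multipartition_vec_nth:
  assumes lam: "lam \<in> multipartitions n \<nu>" and p: "p \<in> {1..length \<nu>}" and j: "j < nth1 \<nu> p"
  shows "multipartition_vec \<nu> lam (sum_list (take (p - 1) \<nu>) + j + 1)
    = (if j < length (nth1 lam p) then of_nat (nth1 lam p ! j) else 0)"
proof -
  define xss where "xss = map2 (\<lambda>a k. a @ replicate (k - length a) 0) lam \<nu>"
  have len: "length lam = length \<nu>" using lam by (simp add: multipartitions_def)
  have le: "length (lam ! q) \<le> \<nu> ! q" if "q < length \<nu>" for q
  proof -
    have "Suc q \<in> {1..length \<nu>}" using that by simp
    then have "length (nth1 lam (Suc q)) \<le> nth1 \<nu> (Suc q)"
      using lam unfolding multipartitions_def by blast
    then show ?thesis by simp
  qed
  \<comment> \<open>Padding makes the p-th segment exactly \<nu>_p long, so segment offsets in the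
    concatenation are prefix sums of \<open>\<nu>\<close>, that is, block offsets.\<close>
  have lens: "map length xss = \<nu>"
    unfolding xss_def using len le by (intro nth_equalityI) auto
  have "sum_list (take (p - 1) \<nu>) + j < sum_list \<nu>"
  proof -
    have "sum_list (take (p - 1) \<nu>) + j + 1 \<in> block \<nu> p"
      unfolding block_conv_image[OF p] using j by auto
    then have "sum_list (take (p - 1) \<nu>) + j + 1 \<in> {1..sum_list \<nu>}"
      unfolding UN_block[symmetric] using p by blast
    then show ?thesis by simp
  qed
  then have "multipartition_vec \<nu> lam (sum_list (take (p - 1) \<nu>) + j + 1)
      = of_nat (concat xss ! (sum_list (map length (take (p - 1) xss)) + j))"
    by (simp add: multipartition_vec_def vec_of_list_def xss_def[symmetric] length_concat lens
        take_map[symmetric])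
  also have "\<dots> = of_nat (xss ! (p - 1) ! j)"
  proof (subst nth_concat_offset)
    have "length xss = length \<nu>" using lens by (metis length_map)
    then show "p - 1 < length xss" using p by auto
    then show "j < length (xss ! (p - 1))" using j lens by (metis nth_map)
  qed simp
  also have "xss ! (p - 1) ! j = (if j < length (nth1 lam p) then nth1 lam p ! j else 0)"
    unfolding xss_def using p len j by (auto simp: nth_append)
  finally show ?thesis by simp
qed

text \<open>Parts decrease weakly and the padding zeroes come last. Real parts are compared because
  the entries are complex numbers.\<close>

lemma multipartition_vec_antimono:
  assumes lam: "lam \<in> multipartitions n \<nu>" and p: "p \<in> {1..length \<nu>}"
    and ij: "i \<in> block \<nu> p" "j \<in> block \<nu> p" "i < j"
  shows "Re (multipartition_vec \<nu> lam j) \<le> Re (multipartition_vec \<nu> lam i)"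
proof -
  obtain a b where a: "i = sum_list (take (p - 1) \<nu>) + a + 1" "a < nth1 \<nu> p"
    and b: "j = sum_list (take (p - 1) \<nu>) + b + 1" "b < nth1 \<nu> p"
    using ij(1,2) unfolding block_conv_image[OF p] by auto
  have "sorted_wrt (\<ge>) (nth1 lam p)"
    using lam p by (auto simp: multipartitions_def is_partition_def)
  then have "b < length (nth1 lam p) \<Longrightarrow> nth1 lam p ! b \<le> nth1 lam p ! a"
    using a b ij(3) by (auto simp: sorted_wrt_iff_nth_less)
  then show ?thesis
    unfolding a(1) b(1) multipartition_vec_nth[OF lam p a(2)] multipartition_vec_nth[OF lam p b(2)]
    using a b ij(3) by auto
qed

text \<open>Parts are positive, so a padding zero cannot be mistaken for a part: the vector
  determines first the lengths and then the entries.\<close>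

lemma multipartition_vec_inj:
  assumes lam: "lam \<in> multipartitions n \<nu>" and mu: "mu \<in> multipartitions n \<nu>"
    and eq: "multipartition_vec \<nu> lam = multipartition_vec \<nu> mu"
  shows "lam = mu"
proof (rule nth_equalityI)
  show len: "length lam = length mu" using lam mu by (simp add: multipartitions_def)
  fix q assume "q < length lam"
  define p where "p = q + 1"
  have p: "p \<in> {1..length \<nu>}" and q: "q = p - 1"
    using \<open>q < length lam\<close> lam by (auto simp: multipartitions_def p_def)
  define x y where "x = nth1 lam p" and "y = nth1 mu p"
  have x: "0 \<notin> set x" "length x \<le> nth1 \<nu> p" and y: "0 \<notin> set y" "length y \<le> nth1 \<nu> p"
    using lam mu p by (auto simp: multipartitions_def is_partition_def x_def y_def)
  have nth: "(if j < length x then x ! j else 0) = (if j < length y then y ! j else 0)"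
    if "j < nth1 \<nu> p" for j
  proof -
    have "(if j < length x then of_nat (x ! j) else 0)
        = (if j < length y then of_nat (y ! j) else (0::complex))"
      using multipartition_vec_nth[OF lam p that] multipartition_vec_nth[OF mu p that]
      unfolding x_def y_def eq by simp
    then show ?thesis by (auto split: if_splits)
  qed
  \<comment> \<open>At index \<open>length x\<close> the padded \<open>x\<close> has a 0, whereas a
    longer \<open>y\<close> would have a positive part there.\<close>
  have "\<not> length x < length y" using nth[of "length x"] y by (auto simp: in_set_conv_nth)
  moreover have "\<not> length y < length x" using nth[of "length y"] x by (auto simp: in_set_conv_nth)
  ultimately have xy: "length x = length y" by simp
  have "x = y"
  proof (rule nth_equalityI[OF xy])
    fix j assume "j < length x"
    then show "x ! j = y ! j" using nth[of j] xy x(2) by simp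
  qed
  then show "lam ! q = mu ! q" by (simp add: x_def y_def q)
qed

text \<open>Since \<open>F i 0 = 0\<close>, the padding contributes nothing and the sum runs over
  actual parts only. It is used for a linear and for a quadratic \<open>F\<close>.\<close>

lemma sum_multipartition_vec:
  assumes lam: "lam \<in> multipartitions n \<nu>" and F0: "\<And>i. F i 0 = 0"
  shows "(\<Sum>i=1..sum_list \<nu>. F i (multipartition_vec \<nu> lam i)) =
    (\<Sum>p=1..length \<nu>. \<Sum>j<length (nth1 lam p).
       F (sum_list (take (p - 1) \<nu>) + j + 1) (of_nat (nth1 lam p ! j)))"
  unfolding sum_blocks
proof (rule sum.cong[OF refl])
  fix p assume p: "p \<in> {1..length \<nu>}"
  let ?o = "sum_list (take (p - 1) \<nu>)" and ?a = "nth1 lam p"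
  have le: "length ?a \<le> nth1 \<nu> p" using lam p by (auto simp: multipartitions_def)
  have "(\<Sum>i\<in>block \<nu> p. F i (multipartition_vec \<nu> lam i))
      = (\<Sum>j<nth1 \<nu> p. if j < length ?a then F (?o + j + 1) (of_nat (?a ! j)) else 0)"
    unfolding sum_block[OF p]
    by (rule sum.cong[OF refl]) (use multipartition_vec_nth[OF lam p] F0 in auto)
  also have "\<dots> = (\<Sum>j<length ?a. F (?o + j + 1) (of_nat (?a ! j)))"
    using le by (intro sum.mono_neutral_cong_right) auto
  finally show "(\<Sum>i\<in>block \<nu> p. F i (multipartition_vec \<nu> lam i))
      = (\<Sum>j<length ?a. F (?o + j + 1) (of_nat (?a ! j)))" .
qed

section \<open>Partition statistics\<close>

lemma n_stat_conj_partition: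
  "n_stat (conj_partition a) = (\<Sum>i<length a. \<Sum>j<a ! i. j)"
proof -
  define M where "M = Max (insert 0 (set a))"
  have M: "a ! i \<le> M" if "i < length a" for i
    unfolding M_def using that by (intro Max_ge) auto
  have "n_stat (conj_partition a) = (\<Sum>j<M. j * card {i. i < length a \<and> j < a ! i})"
    by (simp add: n_stat_def conj_partition_def M_def)
  \<comment> \<open>Double counting of boxes: box (i, j) has weight j. The sum by columns is
    rewritten so that it can be exchanged for a sum by rows; \<open>M\<close> bounds every row
    length.\<close>
  also have "\<dots> = (\<Sum>j<M. \<Sum>i<length a. if j < a ! i then j else 0)"
  proof (rule sum.cong[OF refl])
    fix j
    have "(\<Sum>i<length a. if j < a ! i then j else 0) = (\<Sum>i\<in>{i. i < length a \<and> j < a ! i}. j)"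
      by (intro sum.mono_neutral_cong_right) auto
    then show "j * card {i. i < length a \<and> j < a ! i} = (\<Sum>i<length a. if j < a ! i then j else 0)"
      by simp
  qed
  also have "\<dots> = (\<Sum>i<length a. \<Sum>j<M. if j < a ! i then j else 0)"
    by (rule sum.swap)
  also have "\<dots> = (\<Sum>i<length a. \<Sum>j<a ! i. j)"
  proof (rule sum.cong[OF refl])
    fix i assume "i \<in> {..<length a}"
    then show "(\<Sum>j<M. if j < a ! i then j else 0) = (\<Sum>j<a ! i. j)"
      using M[of i] by (intro sum.mono_neutral_cong_right) auto
  qed
  finally show ?thesis .
qed

text \<open>Row by row this is x^2 = x + 2 (0 + 1 + ... + (x - 1)). It turns the quadratic part of
  the Casimir form into the statistic of the transpose.\<close>

lemma sum_squares_eq_n_stat_conj: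
  "(\<Sum>i<length a. (of_nat (a ! i))\<^sup>2)
    = of_nat (sum_list a) + 2 * (of_nat (n_stat (conj_partition a)) :: complex)"
proof -
  have gauss: "x\<^sup>2 = x + 2 * (\<Sum>j<x. j)" for x :: nat
    by (induction x) (auto simp: power2_eq_square)
  have "(\<Sum>i<length a. (a ! i)\<^sup>2) = (\<Sum>i<length a. a ! i + 2 * (\<Sum>j<a ! i. j))"
    using gauss by (intro sum.cong) auto
  also have "\<dots> = sum_list a + 2 * n_stat (conj_partition a)"
    unfolding n_stat_conj_partition
    by (simp add: sum.distrib sum_distrib_left sum_list_sum_nth atLeast0LessThan)
  finally have "of_nat (\<Sum>i<length a. (a ! i)\<^sup>2)
      = (of_nat (sum_list a + 2 * n_stat (conj_partition a)) :: complex)" by simp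
  then show ?thesis by simp
qed

subsection \<open>The block functional\<close>

text \<open>This is the pairing with l omega0 - sum_i p(i) eps_i, where p(i) is the block
  index.\<close>

definition block_functional :: "nat list \<Rightarrow> aweight \<Rightarrow> complex" where
  "block_functional \<nu> x = (case x of (z, v, k) \<Rightarrow>
     of_nat (length \<nu>) * z - (\<Sum>i=1..sum_list \<nu>. of_nat (block_index \<nu> i) * v i))"

lemma block_functional_add:
  "block_functional \<nu> (x + y) = block_functional \<nu> x + block_functional \<nu> y"
  by (cases x; cases y)
    (simp add: block_functional_def plus_fun_def algebra_simps sum.distrib)

lemma block_functional_sum_list:
  "block_functional \<nu> (sum_list xs) = (\<Sum>x\<leftarrow>xs. block_functional \<nu> x)"
proof (induction xs)
  case Nil
  show ?case by (simp add: block_functional_def zero_prod_def zero_fun_def)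
qed (simp add: block_functional_add)

lemma real_root_eq:
  "eps i - eps j + of_int r \<cdot> delta
    = (of_int r, (\<lambda>t. (if t = i then 1 else 0) - (if t = j then 1 else 0)), 0)"
  by (simp add: eps_def of_vec_def smult_wt_def delta_def fun_eq_iff)

lemma block_functional_real_root:
  assumes "i \<in> {1..sum_list \<nu>}" "j \<in> {1..sum_list \<nu>}"
  shows "block_functional \<nu> (eps i - eps j + of_int r \<cdot> delta)
    = of_int (int (length \<nu>) * r - int (block_index \<nu> i) + int (block_index \<nu> j))"
proof -
  have "(\<Sum>t=1..sum_list \<nu>. of_nat (block_index \<nu> t)
        * ((if t = i then 1 else 0) - (if t = j then 1 else (0::complex))))
      = (\<Sum>t=1..sum_list \<nu>. if t = i then of_nat (block_index \<nu> t) else 0)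
        - (\<Sum>t=1..sum_list \<nu>. if t = j then of_nat (block_index \<nu> t) else 0)"
    by (subst sum_subtractf[symmetric], rule sum.cong) (auto simp: algebra_simps)
  also have "\<dots> = of_nat (block_index \<nu> i) - of_nat (block_index \<nu> j)"
    using assms by simp
  finally show ?thesis by (simp add: real_root_eq block_functional_def)
qed

text \<open>On eps_i - eps_j + r delta the value is l r - p + q with p, q the block indices of i, j.
  Since p - q \<le> l - 1, it is positive for r \<ge> 1. For r = 0 and i < j it is q - p \<ge> 0,
  and it vanishes exactly when i and j share a block. On r delta it is l r.\<close>

lemma block_functional_pos_root:
  assumes "\<nu> \<noteq> []" and "\<alpha> \<in> pos_roots (sum_list \<nu>)"
  shows "block_functional \<nu> \<alpha> \<in> \<nat> - {0} \<or> block_functional \<nu> \<alpha> = 0 \<and> \<alpha> \<in> pos_levi_roots \<nu>"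
proof -
  have pos: "of_int k \<in> \<nat> - {0::complex}" if "k > 0" for k :: int
    using that by (auto simp: of_nat_nat[symmetric] simp del: of_nat_nat)
  from assms(2) consider
      (real) i j r where "\<alpha> = eps i - eps j + of_int r \<cdot> delta" "i \<in> {1..sum_list \<nu>}"
        "j \<in> {1..sum_list \<nu>}" "r > 0 \<or> r = 0 \<and> i < j"
    | (imag) r :: int where "\<alpha> = of_int r \<cdot> delta" "r > 0"
    unfolding pos_roots_def pos_real_roots_def by blast
  then show ?thesis
  proof cases
    case real
    obtain p where p: "p \<in> {1..length \<nu>}" "i \<in> block \<nu> p" "block_index \<nu> i = p"
      using real(2) by (rule block_indexE)
    obtain q where q: "q \<in> {1..length \<nu>}" "j \<in> block \<nu> q" "block_index \<nu> j = q"
      using real(3) by (rule block_indexE)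
    have val: "block_functional \<nu> \<alpha> = of_int (int (length \<nu>) * r - int p + int q)"
      unfolding real(1) block_functional_real_root[OF real(2,3)] p(3) q(3) ..
    show ?thesis
    proof (cases "r > 0")
      case True
      \<comment> \<open>Together with p \<le> l and q \<ge> 1 this gives l r - p + q \<ge>
        1.\<close>
      then have "int (length \<nu>) * 1 \<le> int (length \<nu>) * r" by (intro mult_left_mono) auto
      then have "int (length \<nu>) * r - int p + int q > 0" using p q by auto
      then show ?thesis unfolding val using pos by blast
    next
      case False
      then have r: "r = 0" and "i < j" using real(4) by auto
      then have "p \<le> q" using block_mono p(2) q(2) by (meson less_imp_le)
      show ?thesis
      proof (cases "p = q")
        case True
        have "\<alpha> = eps i - eps j"
          unfolding real(1) r by (simp add: smult_wt_def delta_def eps_def of_vec_def fun_eq_iff)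
        then have "\<alpha> \<in> pos_levi_roots \<nu>"
          unfolding pos_levi_roots_def using \<open>i < j\<close> p q True by blast
        then show ?thesis using val r True by simp
      next
        case False
        then have "int (length \<nu>) * r - int p + int q > 0" using r \<open>p \<le> q\<close> by simp
        then show ?thesis unfolding val using pos by blast
      qed
    qed
  next
    case imag
    have "block_functional \<nu> \<alpha> = of_int (int (length \<nu>) * r)"
      by (simp add: imag block_functional_def smult_wt_def delta_def)
    moreover have "int (length \<nu>) * r > 0" using assms(1) imag(2) by simp
    ultimately show ?thesis using pos by metis
  qed
qed

subsection \<open>Highest weights\<close>

lemma lift_wt_eq:
  "lift_wt m \<kappa> v
    = (- (\<Sum>i=1..m. v i * (2 * rho m i + v i)) / (2 * \<kappa>), v, \<kappa> - of_nat m)"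
  by (simp add: lift_wt_def of_vec_def omega0_def delta_def smult_wt_def pairing_def
      fun_eq_iff zero_fun_def)

lemma pi_vec_eq:
  assumes "i \<in> {1..sum_list \<nu>}"
  shows "pi_vec \<nu> \<kappa> i
    = - of_nat (block_index \<nu> i) * (\<kappa> - of_nat (sum_list \<nu>)) / of_nat (length \<nu>)"
proof -
  obtain p where p: "p \<in> {1..length \<nu>}" "i \<in> block \<nu> p" "block_index \<nu> i = p"
    using assms by (rule block_indexE)
  have "pi_vec \<nu> \<kappa> i = (\<Sum>q=1..length \<nu>. if q = p
     then - of_nat p * (\<kappa> - of_nat (sum_list \<nu>)) / of_nat (length \<nu>) else 0)"
    unfolding pi_vec_def using p block_unique by (intro sum.cong) auto
  then show ?thesis using p by simp
qed

text \<open>Shifting by pi changes the Casimir form only by a constant and the cross term 2 <v :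
  pi>, and pi is a multiple of the block index. So the cross term merges with the linear part of the
  functional. \<open>K\<close> collects whatever depends on pi alone.\<close>

lemma block_functional_verma_highest_weight:
  assumes "\<kappa> \<noteq> 0" "\<nu> \<noteq> []"
  obtains K where "\<And>lam. block_functional \<nu> (verma_highest_weight \<nu> \<kappa> lam) = K
    - of_nat (length \<nu>) / (2 * \<kappa>) * (\<Sum>i=1..sum_list \<nu>.
        multipartition_vec \<nu> lam i * (2 * rho (sum_list \<nu>) i + multipartition_vec \<nu> lam i))
    - of_nat (sum_list \<nu>) / \<kappa> * (\<Sum>i=1..sum_list \<nu>.
        of_nat (block_index \<nu> i) * multipartition_vec \<nu> lam i)"
proof
  fix lam
  define l m v \<pi> P R where "l = (of_nat (length \<nu>) :: complex)"
    and "m = (of_nat (sum_list \<nu>) :: complex)"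
    and "v = multipartition_vec \<nu> lam" and "\<pi> = pi_vec \<nu> \<kappa>"
    and "P = (\<lambda>i. of_nat (block_index \<nu> i) :: complex)" and "R = rho (sum_list \<nu>)"
  let ?S = "\<lambda>f. \<Sum>i=1..sum_list \<nu>. f i"
  have l: "l \<noteq> 0" using assms by (simp add: l_def)
  have "?S (\<lambda>i. v i * \<pi> i) = ?S (\<lambda>i. - (\<kappa> - m) / l * (P i * v i))"
    by (rule sum.cong) (simp_all add: \<pi>_def pi_vec_eq P_def l_def m_def field_simps assms(2))
  then have v\<pi>: "?S (\<lambda>i. v i * \<pi> i) = - (\<kappa> - m) / l * ?S (\<lambda>i. P i * v i)"
    by (simp only: sum_distrib_left)
  have "?S (\<lambda>i. (v i + \<pi> i) * (2 * R i + (v i + \<pi> i)))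
      = ?S (\<lambda>i. v i * (2 * R i + v i) + 2 * (v i * \<pi> i) + \<pi> i * (2 * R i + \<pi> i))"
    by (rule sum.cong) (simp_all add: algebra_simps)
  then have sq: "?S (\<lambda>i. (v i + \<pi> i) * (2 * R i + (v i + \<pi> i)))
      = ?S (\<lambda>i. v i * (2 * R i + v i)) + 2 * ?S (\<lambda>i. v i * \<pi> i) + ?S (\<lambda>i. \<pi> i * (2 * R i + \<pi> i))"
    by (simp only: sum.distrib sum_distrib_left)
  have lin: "?S (\<lambda>i. P i * (v i + \<pi> i)) = ?S (\<lambda>i. P i * v i) + ?S (\<lambda>i. P i * \<pi> i)"
    by (simp only: distrib_left sum.distrib)
  have "block_functional \<nu> (verma_highest_weight \<nu> \<kappa> lam)
      = l * (- ?S (\<lambda>i. (v i + \<pi> i) * (2 * R i + (v i + \<pi> i))) / (2 * \<kappa>))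
        - ?S (\<lambda>i. P i * (v i + \<pi> i))"
    by (simp add: verma_highest_weight_def lift_wt_eq block_functional_def l_def v_def \<pi>_def
        P_def R_def)
  \<comment> \<open>The cross term yields (\<kappa> - m)/\<kappa> times the sum of
    \<open>P i * v i\<close>; subtracting that sum once leaves the coefficient -m/\<kappa>.\<close>
  also have "\<dots> = (- l / (2 * \<kappa>) * ?S (\<lambda>i. \<pi> i * (2 * R i + \<pi> i)) - ?S (\<lambda>i. P i * \<pi> i))
      - l / (2 * \<kappa>) * ?S (\<lambda>i. v i * (2 * R i + v i)) - m / \<kappa> * ?S (\<lambda>i. P i * v i)"
    unfolding sq lin v\<pi> using l assms(1) by (simp add: field_simps)
  \<comment> \<open>The first bracket does not mention \<open>lam\<close> and becomes the witness
    for \<open>K\<close>.\<close>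
  finally show "block_functional \<nu> (verma_highest_weight \<nu> \<kappa> lam)
      = (- of_nat (length \<nu>) / (2 * \<kappa>)
          * (\<Sum>i=1..sum_list \<nu>. pi_vec \<nu> \<kappa> i * (2 * rho (sum_list \<nu>) i + pi_vec \<nu> \<kappa> i))
        - (\<Sum>i=1..sum_list \<nu>. of_nat (block_index \<nu> i) * pi_vec \<nu> \<kappa> i))
    - of_nat (length \<nu>) / (2 * \<kappa>) * (\<Sum>i=1..sum_list \<nu>.
        multipartition_vec \<nu> lam i * (2 * rho (sum_list \<nu>) i + multipartition_vec \<nu> lam i))
    - of_nat (sum_list \<nu>) / \<kappa> * (\<Sum>i=1..sum_list \<nu>.
        of_nat (block_index \<nu> i) * multipartition_vec \<nu> lam i)"
    unfolding l_def m_def v_def \<pi>_def P_def R_def .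
qed

section \<open>The Casimir form and theta as sums over the component partitions\<close>

lemma sum_block_index_multipartition_vec:
  assumes lam: "lam \<in> multipartitions n \<nu>"
  shows "(\<Sum>i=1..sum_list \<nu>. of_nat (block_index \<nu> i) * multipartition_vec \<nu> lam i)
    = (\<Sum>p=1..length \<nu>. of_nat (sum_list (nth1 lam p)) * of_nat p)"
proof (subst sum_multipartition_vec[OF lam], simp, rule sum.cong[OF refl])
  fix p assume p: "p \<in> {1..length \<nu>}"
  let ?a = "nth1 lam p"
  have le: "length ?a \<le> nth1 \<nu> p" using lam p by (auto simp: multipartitions_def)
  have "block_index \<nu> (sum_list (take (p - 1) \<nu>) + j + 1) = p" if "j < length ?a" for j
    using that le by (intro block_index_eq[OF p]) (auto simp only: block_conv_image[OF p])
  then have "(\<Sum>j<length ?a. of_nat (block_index \<nu> (sum_list (take (p - 1) \<nu>) + j + 1)) * of_nat (?a ! j))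
      = (\<Sum>j<length ?a. of_nat p * (of_nat (?a ! j) :: complex))"
    by (intro sum.cong) simp_all
  then show "(\<Sum>j<length ?a. of_nat (block_index \<nu> (sum_list (take (p - 1) \<nu>) + j + 1)) * of_nat (?a ! j))
      = of_nat (sum_list ?a) * (of_nat p :: complex)"
    by (simp add: sum_list_sum_nth atLeast0LessThan sum_distrib_left[symmetric] mult.commute)
qed

text \<open>In block p, rho takes the value m - o - j at list index j, where o is the block offset.
  The terms -2 j \<lambda>_j give -2 n(\<lambda>_p), and the squares give |\<lambda>_p| + 2 n of the
  transpose. The difference of the two statistics is minus the sum of the contents of the
  boxes.\<close>

lemma sum_casimir_multipartition_vec:
  assumes lam: "lam \<in> multipartitions n \<nu>"
  shows "(\<Sum>i=1..sum_list \<nu>.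
      multipartition_vec \<nu> lam i * (2 * rho (sum_list \<nu>) i + multipartition_vec \<nu> lam i))
    = (\<Sum>p=1..length \<nu>. of_nat (sum_list (nth1 lam p))
          * (2 * of_nat (sum_list \<nu>) - 2 * of_nat (sum_list (take (p - 1) \<nu>)) + 1)
        - 2 * (of_nat (n_stat (nth1 lam p)) - of_nat (n_stat (conj_partition (nth1 lam p)))))"
proof (subst sum_multipartition_vec[OF lam], simp, rule sum.cong[OF refl])
  fix p assume p: "p \<in> {1..length \<nu>}"
  let ?a = "nth1 lam p" and ?o = "sum_list (take (p - 1) \<nu>)" and ?m = "sum_list \<nu>"
  have le: "length ?a \<le> nth1 \<nu> p" using lam p by (auto simp: multipartitions_def)
  \<comment> \<open>The position is o + j + 1 and rho subtracts it from m + 1, so the two units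
    cancel.\<close>
  have rho: "rho ?m (?o + j + 1) = of_nat ?m - of_nat ?o - of_nat j" if "j < length ?a" for j
  proof -
    have "?o + j + 1 \<in> block \<nu> p"
      unfolding block_conv_image[OF p] using that le by auto
    then have "?o + j + 1 \<in> {1..?m}" unfolding UN_block[symmetric] using p by blast
    moreover from this have "?m + 1 - (?o + j + 1) = ?m - (?o + j)" "?o + j \<le> ?m" by auto
    ultimately show ?thesis unfolding rho_def by (simp add: of_nat_diff)
  qed
  have "(\<Sum>j<length ?a. of_nat (?a ! j) * (2 * rho ?m (?o + j + 1) + of_nat (?a ! j)))
      = (\<Sum>j<length ?a. (2 * of_nat ?m - 2 * of_nat ?o) * of_nat (?a ! j)
          - 2 * of_nat (j * ?a ! j) + (of_nat (?a ! j))\<^sup>2)"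
  proof (rule sum.cong[OF refl])
    fix j assume "j \<in> {..<length ?a}"
    then have "j < length ?a" by simp
    then show "of_nat (?a ! j) * (2 * rho ?m (?o + j + 1) + of_nat (?a ! j))
        = (2 * of_nat ?m - 2 * of_nat ?o) * of_nat (?a ! j)
          - 2 * of_nat (j * ?a ! j) + (of_nat (?a ! j))\<^sup>2"
      by (subst rho) (simp_all add: algebra_simps power2_eq_square)
  qed
  also have "\<dots> = (2 * of_nat ?m - 2 * of_nat ?o) * of_nat (sum_list ?a)
      - 2 * of_nat (n_stat ?a) + (\<Sum>j<length ?a. (of_nat (?a ! j))\<^sup>2)"
    by (simp add: sum.distrib sum_subtractf sum_distrib_left[symmetric] n_stat_def
        sum_list_sum_nth atLeast0LessThan)
  also have "\<dots> = of_nat (sum_list ?a) * (2 * of_nat ?m - 2 * of_nat ?o + 1)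
      - 2 * (of_nat (n_stat ?a) - of_nat (n_stat (conj_partition ?a)))"
    unfolding sum_squares_eq_n_stat_conj by (simp add: algebra_simps)
  finally show "(\<Sum>j<length ?a. of_nat (?a ! j) * (2 * rho ?m (?o + j + 1) + of_nat (?a ! j)))
      = of_nat (sum_list ?a) * (2 * of_nat ?m - 2 * of_nat ?o + 1)
      - 2 * (of_nat (n_stat ?a) - of_nat (n_stat (conj_partition ?a)))" .
qed

text \<open>Summing the parameters h_r accumulates the entries of \<nu> from the right, starting at
  \<nu>_(l-1). Reversing the multipartition puts \<lambda>_p at position l + 1 - p, so the
  coefficient of |\<lambda>_p| involves the prefix sum up to p - 1, the same offset as in the
  Casimir form.\<close>

lemma theta_rev:
  assumes "\<kappa> \<noteq> 0" and len: "length lam = length \<nu>"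
    and H: "\<And>r. 1 \<le> r \<Longrightarrow> r < length \<nu> \<Longrightarrow> nth1 H r
      = of_nat (nth1 \<nu> (length \<nu> - r)) / \<kappa> - of_nat (sum_list \<nu>) / (of_nat (length \<nu>) * \<kappa>)"
  shows "theta (1 / \<kappa>) H (rev lam) = of_nat (length \<nu>) / \<kappa> * (\<Sum>p=1..length \<nu>.
      of_nat (sum_list (nth1 lam p)) * (of_nat (sum_list (take (length \<nu> - 1) \<nu>))
        - of_nat (sum_list (take (p - 1) \<nu>))
        - (of_nat (length \<nu>) - of_nat p) * of_nat (sum_list \<nu>) / of_nat (length \<nu>))
      - (of_nat (n_stat (nth1 lam p)) - of_nat (n_stat (conj_partition (nth1 lam p)))))"
proof -
  define l where "l = length \<nu>"
  define s where "s p = (of_nat (sum_list (take p \<nu>)) :: complex)" for p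
  \<comment> \<open>Closed form of h_1 + ... + h_(p-1), with \<open>s\<close> the prefix sums of
    \<open>\<nu>\<close>.\<close>
  define c where "c p = (s (l - 1) - s (l - p)) / \<kappa>
    - (of_nat p - 1) * of_nat (sum_list \<nu>) / (of_nat l * \<kappa>)" for p
  have Hsum: "(\<Sum>r=1..p - 1. nth1 H r) = c p" if "1 \<le> p" "p \<le> l" for p
    using that
  proof (induction p rule: dec_induct)
    case base
    show ?case by (simp add: c_def)
  next
    case (step p)
    \<comment> \<open>The new summand h_p contains \<nu>_(l-p), which is the last entry of the
      prefix of length l - p; hence the sum telescopes.\<close>
    have "take (l - p) \<nu> = take (l - Suc p) \<nu> @ [\<nu> ! (l - Suc p)]"
      using step(1,4) take_Suc_conv_app_nth[of "l - Suc p" \<nu>] by (simp add: l_def Suc_diff_Suc)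
    then have "s (l - p) = s (l - Suc p) + of_nat (\<nu> ! (l - Suc p))"
      by (simp add: s_def)
    moreover have "(\<Sum>r=1..Suc p - 1. nth1 H r) = (\<Sum>r=1..p - 1. nth1 H r) + nth1 H p"
      using step(1) by (cases p) simp_all
    moreover have "(\<Sum>r=1..p - 1. nth1 H r) = c p" using step by simp
    moreover have "nth1 H p
        = of_nat (\<nu> ! (l - Suc p)) / \<kappa> - of_nat (sum_list \<nu>) / (of_nat l * \<kappa>)"
      using H[of p] step(1,4) by (simp add: l_def)
    ultimately show ?case
      unfolding c_def by (simp add: diff_divide_distrib add_divide_distrib left_diff_distrib)
  qed
  have rev: "nth1 (rev lam) (l + 1 - p) = nth1 lam p" if "p \<in> {1..l}" for p
    using that len by (subst rev_nth) (auto simp: l_def)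
  let ?N = "\<lambda>a. of_nat (n_stat a) - (of_nat (n_stat (conj_partition a)) :: complex)"
  have flip: "(\<Sum>p=1..l. g p) = (\<Sum>p=1..l. g (l + 1 - p))" for g :: "nat \<Rightarrow> complex"
    using sum.atLeastAtMost_rev[of g 1 l] by simp
  \<comment> \<open>The index p = 1 may be added because its inner sum is empty; the range 1..l is
    then symmetric under p \<mapsto> l + 1 - p.\<close>
  have "(\<Sum>p=2..l. of_nat (sum_list (nth1 (rev lam) p)) * (\<Sum>q=1..p - 1. nth1 H q))
      = (\<Sum>p=1..l. of_nat (sum_list (nth1 (rev lam) p)) * (\<Sum>q=1..p - 1. nth1 H q))"
  proof (intro sum.mono_neutral_left ballI)
    fix p assume "p \<in> {1..l} - {2..l}"
    then have "p = 1" by auto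
    then show "of_nat (sum_list (nth1 (rev lam) p)) * (\<Sum>q=1..p - 1. nth1 H q) = 0" by simp
  qed auto
  also have "\<dots> = (\<Sum>p=1..l. of_nat (sum_list (nth1 lam p)) * c (l + 1 - p))"
    unfolding flip[of "\<lambda>p. of_nat (sum_list (nth1 (rev lam) p)) * (\<Sum>q=1..p - 1. nth1 H q)"]
  proof (rule sum.cong[OF refl])
    fix p assume p: "p \<in> {1..l}"
    then have "(\<Sum>q=1..l + 1 - p - 1. nth1 H q) = c (l + 1 - p)" by (intro Hsum) auto
    then show "of_nat (sum_list (nth1 (rev lam) (l + 1 - p)))
        * (\<Sum>q=1..l + 1 - p - 1. nth1 H q) = of_nat (sum_list (nth1 lam p)) * c (l + 1 - p)"
      by (simp only: rev[OF p])
  qed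
  finally have S1: "(\<Sum>p=2..l. of_nat (sum_list (nth1 (rev lam) p)) * (\<Sum>q=1..p - 1. nth1 H q))
      = (\<Sum>p=1..l. of_nat (sum_list (nth1 lam p)) * c (l + 1 - p))" .
  have S2: "(\<Sum>p=1..l. ?N (nth1 (rev lam) p)) = (\<Sum>p=1..l. ?N (nth1 lam p))"
    unfolding flip[of "\<lambda>p. ?N (nth1 (rev lam) p)"] using rev by (intro sum.cong) simp_all
  have "theta (1 / \<kappa>) H (rev lam)
      = of_nat l * (\<Sum>p=1..l. of_nat (sum_list (nth1 lam p)) * c (l + 1 - p))
        - 1 / \<kappa> * of_nat l * (\<Sum>p=1..l. ?N (nth1 lam p))"
    unfolding theta_def Let_def length_rev len l_def[symmetric] S1 S2 ..
  also have "\<dots> = of_nat l / \<kappa> * (\<Sum>p=1..l. of_nat (sum_list (nth1 lam p)) * (\<kappa> * c (l + 1 - p))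
      - ?N (nth1 lam p))"
    using assms(1)
    by (simp add: sum_subtractf right_diff_distrib sum_distrib_left mult.left_commute)
  also have "\<dots> = of_nat l / \<kappa> * (\<Sum>p=1..l. of_nat (sum_list (nth1 lam p))
      * (s (l - 1) - s (p - 1) - (of_nat l - of_nat p) * of_nat (sum_list \<nu>) / of_nat l)
      - ?N (nth1 lam p))"
  proof -
    have "\<kappa> * c (l + 1 - p)
        = s (l - 1) - s (p - 1) - (of_nat l - of_nat p) * of_nat (sum_list \<nu>) / of_nat l"
      if "p \<in> {1..l}" for p
    proof -
      have "l - (l + 1 - p) = p - 1" and "of_nat (l + 1 - p) - 1 = of_nat l - (of_nat p :: complex)"
        using that by (auto simp: of_nat_diff)
      then show ?thesis using assms(1) unfolding c_def by (simp add: right_diff_distrib diff_divide_distrib)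
    qed
    then show ?thesis by (intro arg_cong2[of _ _ _ _ "(*)"] sum.cong refl) simp
  qed
  finally show ?thesis unfolding l_def s_def .
qed

text \<open>Both sides are combinations of the sizes |\<lambda>_p| weighted by 1, by the block
  offset and by p, and of the content sums. All but the unweighted sizes cancel in the sum of theta
  and the functional, and the sizes add up to \<open>n\<close>, so \<open>C\<close> is the same for
  every multipartition of \<open>n\<close>.\<close>

lemma theta_rev_eq_block_functional:
  assumes "\<kappa> \<noteq> 0" "\<nu> \<noteq> []"
    and H: "\<And>r. 1 \<le> r \<Longrightarrow> r < length \<nu> \<Longrightarrow> nth1 H r
      = of_nat (nth1 \<nu> (length \<nu> - r)) / \<kappa> - of_nat (sum_list \<nu>) / (of_nat (length \<nu>) * \<kappa>)"
  obtains C where "\<And>lam. lam \<in> multipartitions n \<nu> \<Longrightarrow>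
    theta (1 / \<kappa>) H (rev lam) = C - block_functional \<nu> (verma_highest_weight \<nu> \<kappa> lam)"
proof -
  obtain K where K: "\<And>lam. block_functional \<nu> (verma_highest_weight \<nu> \<kappa> lam) = K
    - of_nat (length \<nu>) / (2 * \<kappa>) * (\<Sum>i=1..sum_list \<nu>.
        multipartition_vec \<nu> lam i * (2 * rho (sum_list \<nu>) i + multipartition_vec \<nu> lam i))
    - of_nat (sum_list \<nu>) / \<kappa> * (\<Sum>i=1..sum_list \<nu>.
        of_nat (block_index \<nu> i) * multipartition_vec \<nu> lam i)"
    using block_functional_verma_highest_weight[OF assms(1,2)] by blast
  define l m S where "l = (of_nat (length \<nu>) :: complex)" and "m = (of_nat (sum_list \<nu>) :: complex)"
    and "S = (of_nat (sum_list (take (length \<nu> - 1) \<nu>)) :: complex)"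
  have l: "l \<noteq> 0" using assms by (simp add: l_def)
  show thesis
  proof (rule that)
    fix lam assume lam: "lam \<in> multipartitions n \<nu>"
    define x s d where "x = (\<lambda>p. of_nat (sum_list (nth1 lam p)) :: complex)"
      and "s = (\<lambda>p. of_nat (sum_list (take (p - 1) \<nu>)) :: complex)"
      and "d = (\<lambda>p. of_nat (n_stat (nth1 lam p))
        - of_nat (n_stat (conj_partition (nth1 lam p))) :: complex)"
    let ?S = "\<lambda>f. \<Sum>p=1..length \<nu>. f p"
    have len: "length lam = length \<nu>" using lam by (simp add: multipartitions_def)
    have n: "?S x = of_nat n"
      using lam unfolding x_def multipartitions_def by (auto simp flip: of_nat_sum)
    have "theta (1 / \<kappa>) H (rev lam)
        = l / \<kappa> * ?S (\<lambda>p. x p * (S - s p - (l - of_nat p) * m / l) - d p)"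
      unfolding l_def m_def S_def x_def s_def d_def
      by (rule theta_rev[OF assms(1) len]) (rule H)
    also have "?S (\<lambda>p. x p * (S - s p - (l - of_nat p) * m / l) - d p)
        = ?S (\<lambda>p. (S - m) * x p - x p * s p + m / l * (x p * of_nat p) - d p)"
      using l by (intro sum.cong) (simp_all add: field_simps)
    also have "\<dots> = (S - m) * of_nat n - ?S (\<lambda>p. x p * s p) + m / l * ?S (\<lambda>p. x p * of_nat p) - ?S d"
      unfolding n[symmetric] by (simp only: sum_subtractf sum.distrib sum_distrib_left)
    finally have th: "theta (1 / \<kappa>) H (rev lam) = l / \<kappa> *
        ((S - m) * of_nat n - ?S (\<lambda>p. x p * s p) + m / l * ?S (\<lambda>p. x p * of_nat p) - ?S d)" .
    have "block_functional \<nu> (verma_highest_weight \<nu> \<kappa> lam)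
        = K - l / (2 * \<kappa>) * ?S (\<lambda>p. x p * (2 * m - 2 * s p + 1) - 2 * d p)
          - m / \<kappa> * ?S (\<lambda>p. x p * of_nat p)"
      unfolding K sum_block_index_multipartition_vec[OF lam] sum_casimir_multipartition_vec[OF lam]
        l_def m_def x_def s_def d_def ..
    also have "?S (\<lambda>p. x p * (2 * m - 2 * s p + 1) - 2 * d p)
        = ?S (\<lambda>p. (2 * m + 1) * x p - 2 * (x p * s p) - 2 * d p)"
      by (intro sum.cong) (simp_all add: algebra_simps)
    also have "\<dots> = (2 * m + 1) * of_nat n - 2 * ?S (\<lambda>p. x p * s p) - 2 * ?S d"
      unfolding n[symmetric] by (simp only: sum_subtractf sum.distrib sum_distrib_left)
    finally have bf: "block_functional \<nu> (verma_highest_weight \<nu> \<kappa> lam) = K - l / (2 * \<kappa>)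
        * ((2 * m + 1) * of_nat n - 2 * ?S (\<lambda>p. x p * s p) - 2 * ?S d)
        - m / \<kappa> * ?S (\<lambda>p. x p * of_nat p)" .
    \<comment> \<open>The bracket is the witness for \<open>C\<close>: the constant \<open>K\<close>
      and the terms proportional to \<open>n\<close>.\<close>
    show "theta (1 / \<kappa>) H (rev lam)
        = (K + l / \<kappa> * (S - m) * of_nat n - l / (2 * \<kappa>) * (2 * m + 1) * of_nat n)
          - block_functional \<nu> (verma_highest_weight \<nu> \<kappa> lam)"
      unfolding th bf using l assms(1) by (simp add: field_simps)
  qed
qed

section \<open>Chains of linked weights, and differences made of Levi roots only\<close>

lemma linked_up_rtranclp_diff:
  assumes "(linked_up \<nu>)\<^sup>*\<^sup>* x y"
  obtains \<alpha>s where "y - x = sum_list \<alpha>s" "set \<alpha>s \<subseteq> pos_roots (sum_list \<nu>)"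
  using assms
proof (induction arbitrary: thesis rule: rtranclp_induct)
  case base
  show ?case by (rule base[of "[]"]) simp_all
next
  case (step y z)
  obtain \<alpha>s where \<alpha>s: "y - x = sum_list \<alpha>s" "set \<alpha>s \<subseteq> pos_roots (sum_list \<nu>)"
    using step.IH by blast
  \<comment> \<open>Each link carries \<open>wt_less\<close>, which supplies a list of positive
    roots; lists are concatenated along the chain.\<close>
  obtain \<beta>s where \<beta>s: "z - y = sum_list \<beta>s" "set \<beta>s \<subseteq> pos_roots (sum_list \<nu>)"
    using step.hyps(2) unfolding linked_up_def wt_less_def Let_def by blast
  have "z - x = sum_list (\<alpha>s @ \<beta>s)"
    unfolding sum_list_append \<alpha>s(1)[symmetric] \<beta>s(1)[symmetric] by simp
  then show ?case using step.prems \<alpha>s(2) \<beta>s(2) by (metis Un_least set_append)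
qed

lemma pairing_add_left: "pairing m (x + y) w = pairing m x w + pairing m y w"
  by (cases x; cases y; cases w) (simp add: pairing_def plus_fun_def algebra_simps sum.distrib)

lemma pairing_sum_list_left: "pairing m (sum_list xs) w = (\<Sum>x\<leftarrow>xs. pairing m x w)"
proof (induction xs)
  case Nil
  show ?case by (cases w) (simp add: pairing_def zero_prod_def zero_fun_def)
qed (simp add: pairing_add_left)

lemma levi_root_eq:
  "eps i - eps j = (0, (\<lambda>t. (if t = i then 1 else 0) - (if t = j then 1 else 0)), 0)"
  by (simp add: eps_def of_vec_def fun_eq_iff)

text \<open>Levi roots have no delta-component, so the two Casimir values agree, which says that u -
  v is orthogonal to u + v + 2 rho. But every positive Levi root pairs with that vector with
  positive real part, so a nonempty sum of such roots is impossible.\<close>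

lemma verma_highest_weight_diff_levi:
  assumes "\<kappa> \<noteq> 0" and lam: "lam \<in> multipartitions n \<nu>" and mu: "mu \<in> multipartitions n \<nu>"
    and diff: "verma_highest_weight \<nu> \<kappa> lam - verma_highest_weight \<nu> \<kappa> mu = sum_list \<alpha>s"
    and levi: "set \<alpha>s \<subseteq> pos_levi_roots \<nu>"
  shows "mu = lam"
proof -
  define m where "m = sum_list \<nu>"
  define u v where "u = multipartition_vec \<nu> lam + pi_vec \<nu> \<kappa>"
    and "v = multipartition_vec \<nu> mu + pi_vec \<nu> \<kappa>"
  \<comment> \<open>The second factor in |u + rho|^2 - |v + rho|^2 = <u - v : u + v + 2
    rho>.\<close>
  define g where "g i = 2 * rho m i + u i + v i" for i
  have hw: "verma_highest_weight \<nu> \<kappa> lam = lift_wt m \<kappa> u"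
    "verma_highest_weight \<nu> \<kappa> mu = lift_wt m \<kappa> v"
    by (simp_all add: verma_highest_weight_def m_def u_def v_def)
  have "fst (sum_list \<alpha>s) = 0"
    using levi by (induction \<alpha>s) (auto simp: pos_levi_roots_def levi_root_eq)
  then have "(\<Sum>i=1..m. u i * (2 * rho m i + u i)) = (\<Sum>i=1..m. v i * (2 * rho m i + v i))"
    using \<open>\<kappa> \<noteq> 0\<close> unfolding diff[symmetric] hw lift_wt_eq by (simp add: field_simps)
  moreover have "(\<Sum>i=1..m. (u i - v i) * g i)
      = (\<Sum>i=1..m. u i * (2 * rho m i + u i)) - (\<Sum>i=1..m. v i * (2 * rho m i + v i))"
    unfolding sum_subtractf[symmetric] by (rule sum.cong) (simp_all add: g_def algebra_simps)
  ultimately have "pairing m (sum_list \<alpha>s) (of_vec g) = 0"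
    unfolding diff[symmetric] hw lift_wt_eq by (simp add: pairing_def of_vec_def)
  then have zero: "(\<Sum>\<alpha>\<leftarrow>\<alpha>s. pairing m \<alpha> (of_vec g)) = 0" by (simp add: pairing_sum_list_left)
  have pos: "Re (pairing m \<alpha> (of_vec g)) > 0" if \<alpha>: "\<alpha> \<in> pos_levi_roots \<nu>" for \<alpha>
  proof -
    obtain i j p where ij: "\<alpha> = eps i - eps j" "i < j" and p: "p \<in> {1..length \<nu>}"
      and mem: "i \<in> block \<nu> p" "j \<in> block \<nu> p"
      using \<alpha> unfolding pos_levi_roots_def by blast
    have rng: "i \<in> {1..m}" "j \<in> {1..m}"
      using p mem unfolding m_def UN_block[symmetric] by blast+
    have "pairing m \<alpha> (of_vec g)
        = (\<Sum>t=1..m. ((if t = i then 1 else 0) - (if t = j then 1 else 0)) * g t)"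
      by (simp add: ij(1) levi_root_eq of_vec_def pairing_def)
    also have "\<dots> = (\<Sum>t=1..m. (if t = i then g t else 0)) - (\<Sum>t=1..m. (if t = j then g t else 0))"
      unfolding sum_subtractf[symmetric] by (rule sum.cong) auto
    also have "\<dots> = g i - g j" using rng by simp
    finally have "pairing m \<alpha> (of_vec g) = g i - g j" .
    \<comment> \<open>Within a block pi is constant and cancels, both partitions decrease weakly,
      and rho decreases strictly; the strictness comes from rho alone.\<close>
    moreover have "pi_vec \<nu> \<kappa> i = pi_vec \<nu> \<kappa> j"
      using rng p mem by (simp add: pi_vec_eq m_def block_index_eq)
    moreover have "Re (rho m j) < Re (rho m i)"
      using rng ij(2) by (simp add: rho_def)
    moreover note multipartition_vec_antimono[OF lam p mem ij(2)]
      multipartition_vec_antimono[OF mu p mem ij(2)]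
    ultimately show ?thesis by (simp add: g_def u_def v_def)
  qed
  have "\<alpha>s = []"
  proof (rule ccontr)
    assume "\<alpha>s \<noteq> []"
    then have "Re (\<Sum>\<alpha>\<leftarrow>\<alpha>s. pairing m \<alpha> (of_vec g)) > 0"
      using levi
    proof (induction \<alpha>s rule: list_nonempty_induct)
      case (single x)
      then show ?case using pos by simp
    next
      case (cons x xs)
      then show ?case using pos[of x] by simp
    qed
    then show False unfolding zero by simp
  qed
  then have "u = v" using diff unfolding hw lift_wt_eq by (simp add: zero_prod_def)
  then have "multipartition_vec \<nu> lam = multipartition_vec \<nu> mu"
    by (simp add: u_def v_def)
  then show ?thesis using multipartition_vec_inj[OF lam mu] by simp
qed

theorem proposition6p4:
  fixes n l m :: nat and \<nu> :: "nat list" and \<kappa> h :: complex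
    and hp :: "nat \<Rightarrow> complex" and H :: "complex list"
    and lam mu :: "nat list list"
  assumes "n \<ge> 1" and "l \<ge> 1" and "m \<ge> 1"
    and "length \<nu> = l" and "sum_list \<nu> = m"
    and "\<nexists>q::rat. q \<ge> 0 \<and> \<kappa> = of_rat q"
    and "h = 1 / \<kappa>"
    and "\<And>p. 1 \<le> p \<Longrightarrow> p \<le> l - 1 \<Longrightarrow>
           hp p = of_nat (nth1 \<nu> (l - p)) / \<kappa> - of_nat m / (of_nat l * \<kappa>)"
    and "hp l = of_nat (nth1 \<nu> l) / \<kappa> - of_nat m / (of_nat l * \<kappa>)"
    and "H = map hp [1..<l]"
    and "lam \<in> multipartitions n \<nu>" and "mu \<in> multipartitions n \<nu>"
    and "verma_le \<nu> \<kappa> mu lam"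
  shows "cherednik_le h H (rev mu) (rev lam)"
proof -
  \<comment> \<open>0 is one of the excluded nonnegative rationals.\<close>
  have \<kappa>: "\<kappa> \<noteq> 0" using assms(6) by (metis of_rat_0 order_refl)
  have \<nu>: "\<nu> \<noteq> []" using assms(2,4) by auto
  have H: "nth1 H r = of_nat (nth1 \<nu> (length \<nu> - r)) / \<kappa>
      - of_nat (sum_list \<nu>) / (of_nat (length \<nu>) * \<kappa>)" if "1 \<le> r" "r < length \<nu>" for r
    using that assms(4,5,8,10) by simp
  obtain C where C: "\<And>lam. lam \<in> multipartitions n \<nu> \<Longrightarrow>
      theta (1 / \<kappa>) H (rev lam) = C - block_functional \<nu> (verma_highest_weight \<nu> \<kappa> lam)"
    using theta_rev_eq_block_functional[OF \<kappa> \<nu> H] by blast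
  obtain \<alpha>s where diff: "verma_highest_weight \<nu> \<kappa> lam - verma_highest_weight \<nu> \<kappa> mu = sum_list \<alpha>s"
    and \<alpha>s: "set \<alpha>s \<subseteq> pos_roots (sum_list \<nu>)"
    using assms(13) linked_up_rtranclp_diff unfolding verma_le_def affine_le_def by blast
  have "verma_highest_weight \<nu> \<kappa> lam = verma_highest_weight \<nu> \<kappa> mu + sum_list \<alpha>s"
    using diff by (metis add_diff_cancel_left' diff_add_cancel add.commute)
  \<comment> \<open>Theta is \<open>C\<close> minus the functional, so the roles of
    \<open>mu\<close> and \<open>lam\<close> swap and the constant drops out.\<close>
  then have theta: "theta h H (rev mu) - theta h H (rev lam)
      = (\<Sum>\<alpha>\<leftarrow>\<alpha>s. block_functional \<nu> \<alpha>)"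
    using C[OF assms(11)] C[OF assms(12)]
    by (simp add: assms(7) block_functional_add block_functional_sum_list)
  \<comment> \<open>Every summand is a natural number, so the total is zero only if each one is, and
    then every root in the list is a positive Levi root. The first alternative gives the strict
    order, the second gives \<open>mu = lam\<close>.\<close>
  have "(\<Sum>\<alpha>\<leftarrow>\<alpha>s. block_functional \<nu> \<alpha>) \<in> \<nat> - {0} \<or>
      (\<Sum>\<alpha>\<leftarrow>\<alpha>s. block_functional \<nu> \<alpha>) = 0 \<and> set \<alpha>s \<subseteq> pos_levi_roots \<nu>"
    using \<alpha>s
  proof (induction \<alpha>s)
    case (Cons \<alpha> \<alpha>s)
    have add: "a + b \<in> \<nat> - {0}" if "a \<in> \<nat> - {0}" "b \<in> \<nat> - {0}" for a b :: complex
      using that by (auto elim!: Nats_cases simp flip: of_nat_add)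
    show ?case
      using Cons block_functional_pos_root[OF \<nu>, of \<alpha>] add by auto
  qed simp
  then show ?thesis
    using theta verma_highest_weight_diff_levi[OF \<kappa> assms(11,12) diff]
    unfolding cherednik_le_def cherednik_less_def by auto
qed

end
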